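(* Let $n\geqslant 4$ be an integer and let $S\subseteq \mathbb{Z}_n$ be such that the Cayley sum graph $\mathrm{CS}(\mathbb{Z}_n,S)$ is connected and of degree $k=|S|$, where $k\mid n$. Then $\mathrm{CS}(\mathbb{Z}_n,S)$ admits a subgroup total perfect code if and only if $s\not\equiv s'\pmod{k}$ for all distinct $s,s'\in S$.
   Context: For an additive group $G$ and a subset $S\subseteq G$ closed under conjugation (automatic when $G$ is abelian), the Cayley sum graph $\mathrm{CS}(G,S)$ has vertex set $G$, two vertices $g,h$ being adjacent if and only if $g+h\in S$ and $g\neq h$. A total perfect code of a graph $\Gamma$ is a subset $C$ of vertices such that every vertex of $\Gamma$ has exactly one neighbor in $C$. A subgroup total perfect code is a total perfect code of $\mathrm{CS}(G,S)$ that is also a subgroup of $G$. Elements of $\mathbb{Z}_n$ are identified with integers $0,\dots,n-1$. *)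

theory Defs
  imports
    "Graph_Theory.Graph_Theory"
    "HOL-Algebra.Elementary_Groups"
    "HOL-Number_Theory.Cong"
begin

text \<open>
  Groups are the multiplicatively written records of HOL-Algebra, so a sum \<open>g + h\<close> appears as
  \<open>g \<otimes>\<^bsub>G\<^esub> h\<close>; the group \<open>\<int>\<^sub>n\<close> is \<^term>\<open>integer_mod_group n\<close>.
  A simple graph is a loop-free symmetric digraph with at most one arc for each ordered pair.
\<close>

definition cayley_sum_graph :: "('a, 'b) monoid_scheme \<Rightarrow> 'a set \<Rightarrow> ('a, 'a \<times> 'a) pre_digraph" where
  "cayley_sum_graph G S = with_proj
     \<lparr>pverts = carrier G,
      parcs = {(g, h). g \<in> carrier G \<and> h \<in> carrier G \<and> g \<otimes>\<^bsub>G\<^esub> h \<in> S \<and> g \<noteq> h}\<rparr>"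

text \<open>
  Closure of \<open>S\<close> under conjugation, which makes adjacency symmetric, is automatic in the
  abelian case.
\<close>

lemma graph_cayley_sum_graph:
  assumes "comm_group G" "finite (carrier G)"
  shows "graph (cayley_sum_graph G S)"
proof -
  interpret comm_group G by fact
  have "finite {(g, h). g \<in> carrier G \<and> h \<in> carrier G \<and> g \<otimes>\<^bsub>G\<^esub> h \<in> S \<and> g \<noteq> h}"
    by (rule finite_subset[of _ "carrier G \<times> carrier G"]) (use assms(2) in auto)
  then show ?thesis
    using assms(2)
    by unfold_locales
      (auto simp: cayley_sum_graph_def with_proj_def arc_to_ends_def symmetric_def
        arcs_ends_def image_def m_comm intro!: symI)
qed

definition total_perfect_code :: "('a, 'b) pre_digraph \<Rightarrow> 'a set \<Rightarrow> bool" where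
  "total_perfect_code \<Gamma> C \<longleftrightarrow>
     C \<subseteq> verts \<Gamma> \<and> (\<forall>v \<in> verts \<Gamma>. \<exists>!c. c \<in> C \<and> v \<rightarrow>\<^bsub>\<Gamma>\<^esub> c)"

definition subgroup_total_perfect_code :: "('a, 'b) monoid_scheme \<Rightarrow> 'a set \<Rightarrow> 'a set \<Rightarrow> bool" where
  "subgroup_total_perfect_code G S C \<longleftrightarrow>
     subgroup C G \<and> total_perfect_code (cayley_sum_graph G S) C"

text \<open>Every arc of a symmetric digraph has its reverse, so \<^const>\<open>out_degree\<close> counts neighbours.\<close>

definition regular_of_degree :: "('a, 'b) pre_digraph \<Rightarrow> nat \<Rightarrow> bool" where
  "regular_of_degree \<Gamma> k \<longleftrightarrow> (\<forall>v \<in> verts \<Gamma>. out_degree \<Gamma> v = k)"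

end

theory Submission
  imports Defs "HOL-Algebra.Multiplicative_Group"
begin

text \<open>
  Regularity of degree \<open>|S|\<close> forces \<open>2 v \<notin> S\<close> for every \<open>v\<close>: otherwise \<open>v\<close> would lose the
  neighbour \<open>2 v - v = v\<close>. So \<open>C\<close> is a total perfect code iff every \<open>v\<close> is \<open>s - c\<close> for a unique
  pair \<open>(s, c) \<in> S \<times> C\<close>, whence \<open>|S| |C| = n\<close>. A subgroup code can therefore only be
  the subgroup \<open>k \<int>\<^sub>n\<close> of order \<open>n / k\<close>, and \<open>k \<int>\<^sub>n\<close> is a code iff \<open>S\<close> is a transversal of its
  cosets, the residue classes mod \<open>k\<close>.
\<close>

section \<open>Adjacency and perfect codes in Cayley sum graphs\<close>

lemma verts_cayley_sum_graph [simp]: "verts (cayley_sum_graph G S) = carrier G"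
  by (simp add: cayley_sum_graph_def with_proj_def)

lemma dominates_cayley_sum_graph:
  "v \<rightarrow>\<^bsub>cayley_sum_graph G S\<^esub> c \<longleftrightarrow>
     v \<in> carrier G \<and> c \<in> carrier G \<and> v \<otimes>\<^bsub>G\<^esub> c \<in> S \<and> v \<noteq> c"
  by (auto simp: cayley_sum_graph_def with_proj_def arc_to_ends_def arcs_ends_def image_def)

lemma out_arcs_cayley_sum_graph:
  "out_arcs (cayley_sum_graph G S) v =
     {(g, h). g = v \<and> v \<in> carrier G \<and> h \<in> carrier G \<and> v \<otimes>\<^bsub>G\<^esub> h \<in> S \<and> v \<noteq> h}"
  by (auto simp: cayley_sum_graph_def with_proj_def out_arcs_def)

context group
begin

text \<open>Sending an arc to the sum of its ends embeds the arcs leaving \<open>x\<close> into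
  \<open>S\<close>. The value \<open>x \<otimes> x\<close> is never hit, since by cancellation only
  a loop could produce it; if it lay in \<open>S\<close>, the out-degree would drop below
  \<open>card S\<close>.\<close>

lemma square_notin_if_regular_cayley_sum_graph:
  assumes "finite S" "regular_of_degree (cayley_sum_graph G S) (card S)" "x \<in> carrier G"
  shows "x \<otimes> x \<notin> S"
proof
  assume "x \<otimes> x \<in> S"
  let ?A = "out_arcs (cayley_sum_graph G S) x"
  have "inj_on (\<lambda>(g, h). g \<otimes> h) ?A"
    by (auto simp: inj_on_def out_arcs_cayley_sum_graph)
  moreover have "(\<lambda>(g, h). g \<otimes> h) ` ?A \<subseteq> S - {x \<otimes> x}"
    using assms(3) by (auto simp: out_arcs_cayley_sum_graph)
  ultimately have "card ?A \<le> card (S - {x \<otimes> x})"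
    using assms(1) by (intro card_inj_on_le[where f = "\<lambda>(g, h). g \<otimes> h"]) auto
  also have "\<dots> < card S"
    using assms(1) \<open>x \<otimes> x \<in> S\<close> by (rule card_Diff1_less)
  finally show False
    using assms(2,3) by (simp add: regular_of_degree_def out_degree_def)
qed

text \<open>Once \<open>S\<close> contains no squares, \<open>v \<otimes> c \<in> S\<close> already
  forces \<open>v \<noteq> c\<close>, so loop-freeness disappears from the adjacency
  condition.\<close>

lemma total_perfect_code_cayley_sum_graph_iff:
  assumes "\<And>x. x \<in> carrier G \<Longrightarrow> x \<otimes> x \<notin> S" "C \<subseteq> carrier G"
  shows "total_perfect_code (cayley_sum_graph G S) C \<longleftrightarrow>
    (\<forall>v \<in> carrier G. \<exists>!c. c \<in> C \<and> v \<otimes> c \<in> S)"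
proof -
  have "c \<in> C \<and> v \<rightarrow>\<^bsub>cayley_sum_graph G S\<^esub> c \<longleftrightarrow> c \<in> C \<and> v \<otimes> c \<in> S"
    if "v \<in> carrier G" for v c
    using that assms by (auto simp: dominates_cayley_sum_graph)
  then show ?thesis
    using assms(2) by (simp add: total_perfect_code_def)
qed

text \<open>The map \<open>(s, c) \<mapsto> s \<otimes> inv c\<close> is a bijection from
  \<open>S \<times> C\<close> to the group: existence of \<open>c\<close> gives surjectivity,
  uniqueness gives injectivity.\<close>

lemma card_mult_card_eq_order:
  assumes "S \<subseteq> carrier G" "C \<subseteq> carrier G"
    and unique: "\<forall>v \<in> carrier G. \<exists>!c. c \<in> C \<and> v \<otimes> c \<in> S"
  shows "card S * card C = order G"
proof -
  have "bij_betw (\<lambda>(s, c). s \<otimes> inv c) (S \<times> C) (carrier G)"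
  proof (rule bij_betwI')
    fix p q assume pq: "p \<in> S \<times> C" "q \<in> S \<times> C"
    obtain s c t d where [simp]: "p = (s, c)" "q = (t, d)"
      by (cases p, cases q)
    have in_G: "s \<in> carrier G" "c \<in> carrier G" "t \<in> carrier G" "d \<in> carrier G"
      using pq assms(1,2) by auto
    have "p = q" if eq: "s \<otimes> inv c = t \<otimes> inv d"
    proof -
      \<comment> \<open>The common value of both sides is a vertex whose sums with \<open>c\<close>
        and with \<open>d\<close> both lie in \<open>S\<close>.\<close>
      have "(s \<otimes> inv c) \<otimes> c = s" "(t \<otimes> inv d) \<otimes> d = t"
        using in_G by (simp_all add: m_assoc)
      moreover have "s \<otimes> inv c \<in> carrier G"
        using in_G by simp
      ultimately have "c = d"
        using unique[rule_format, of "s \<otimes> inv c"] pq eq by auto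
      then show ?thesis
        using eq in_G by simp
    qed
    then show "((case p of (s, c) \<Rightarrow> s \<otimes> inv c) = (case q of (s, c) \<Rightarrow> s \<otimes> inv c)) = (p = q)"
      by auto
  next
    fix p assume "p \<in> S \<times> C"
    then show "(case p of (s, c) \<Rightarrow> s \<otimes> inv c) \<in> carrier G"
      using assms(1,2) by auto
  next
    fix v assume v: "v \<in> carrier G"
    then obtain c where c: "c \<in> C" "v \<otimes> c \<in> S"
      using unique by blast
    then have "v = (v \<otimes> c) \<otimes> inv c"
      using v assms(2) by (simp add: m_assoc subset_iff)
    then show "\<exists>p \<in> S \<times> C. v = (case p of (s, c) \<Rightarrow> s \<otimes> inv c)"
      using c by (intro bexI[of _ "(v \<otimes> c, c)"]) auto
  qed
  then show ?thesis
    by (metis bij_betw_same_card card_cartesian_product order_def)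
qed

end

section \<open>Subgroups of \<open>integer_mod_group n\<close>\<close>

lemma subgroup_multiples_integer_mod_group:
  assumes "k dvd n"
  shows "subgroup {x \<in> carrier (integer_mod_group n). int k dvd x} (integer_mod_group n)"
proof -
  \<comment> \<open>The group operation reduces mod \<open>n\<close>; since \<open>k\<close> divides
    \<open>n\<close>, this does not affect divisibility by \<open>k\<close>.\<close>
  have *: "int k dvd x mod int n \<longleftrightarrow> int k dvd x" for x
    using assms by (simp add: dvd_mod_iff)
  show ?thesis
    by (rule group.subgroupI)
      (auto simp: * carrier_integer_mod_group intro!: exI[of _ 0] dvd_add)
qed

lemma card_multiples_less:
  assumes "n > 0" "m * k = n"
  shows "card {x \<in> {0..<int n}. int k dvd x} = m"
proof -
  have "k > 0"
    using assms by (cases k) auto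
  have "{x \<in> {0..<int n}. int k dvd x} = (\<lambda>i. int k * i) ` {0..<int m}"
  proof (intro equalityI subsetI)
    fix x assume x: "x \<in> {x \<in> {0..<int n}. int k dvd x}"
    then obtain i where i: "x = int k * i"
      by blast
    have "int n = int k * int m"
      using assms(2) by (metis mult.commute of_nat_mult)
    then have "0 \<le> i" "i < int m"
      using x i \<open>k > 0\<close> by (auto simp: zero_le_mult_iff)
    then show "x \<in> (\<lambda>i. int k * i) ` {0..<int m}"
      using i by auto
  qed (use \<open>k > 0\<close> assms(2) in \<open>auto simp: mult.commute\<close>)
  moreover have "inj_on (\<lambda>i. int k * i) {0..<int m}"
    using \<open>k > 0\<close> by (auto simp: inj_on_def)
  ultimately show ?thesis
    by (simp add: card_image)
qed

text \<open>By Lagrange, \<open>card C\<close> annihilates each \<open>x \<in> C\<close>, so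
  \<open>n = card C * k\<close> divides \<open>card C * x\<close>, and hence \<open>k\<close>
  divides \<open>x\<close>. Thus \<open>C\<close> lies among the multiples of \<open>k\<close>,
  which are equally many.\<close>

lemma subgroup_integer_mod_group_eq_multiples:
  assumes "n > 0" "subgroup C (integer_mod_group n)" "card C * k = n"
  shows "C = {x \<in> carrier (integer_mod_group n). int k dvd x}"
proof (rule card_subset_eq)
  let ?G = "integer_mod_group n"
  interpret group ?G
    by simp
  have sub: "C \<subseteq> carrier ?G"
    using assms(2) by (rule subgroup.subset)
  show "finite {x \<in> carrier ?G. int k dvd x}"
    by (rule finite_subset[of _ "{0..<int n}"]) (use assms(1) in \<open>auto simp: carrier_integer_mod_group\<close>)
  show "card C = card {x \<in> carrier ?G. int k dvd x}"
    using card_multiples_less[OF assms(1,3)] assms(1) by (simp add: carrier_integer_mod_group)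
  show "C \<subseteq> {x \<in> carrier ?G. int k dvd x}"
  proof
    fix x assume x: "x \<in> C"
    interpret C: group "?G\<lparr>carrier := C\<rparr>"
      using assms(2) by (rule subgroup_imp_group)
    \<comment> \<open>Taking \<open>C\<close> as a group of its own yields the exponent
      \<open>card C\<close> instead of \<open>n\<close>.\<close>
    have "x [^]\<^bsub>?G\<^esub> card C = \<one>\<^bsub>?G\<^esub>"
      using C.pow_order_eq_1[of x] x by (simp add: order_def nat_pow_consistent[symmetric])
    then have "int n dvd int (card C) * x"
      by (simp add: dvd_eq_mod_eq_0)
    then have "int (card C) * int k dvd int (card C) * x"
      using assms(3) by (metis of_nat_mult)
    moreover have "card C \<noteq> 0"
      using assms(1,3) by (cases "card C") auto
    ultimately show "x \<in> {x \<in> carrier ?G. int k dvd x}"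
      using x sub by auto
  qed
qed

theorem theorem3p2:
  fixes n k :: nat and S :: "int set"
  assumes "n \<ge> 4"
    and "S \<subseteq> carrier (integer_mod_group n)"
    and "Digraph_Component.connected (cayley_sum_graph (integer_mod_group n) S)"
    and "regular_of_degree (cayley_sum_graph (integer_mod_group n) S) k"
    and "k = card S"
    and "k dvd n"
  shows "(\<exists>C. subgroup_total_perfect_code (integer_mod_group n) S C) \<longleftrightarrow>
    (\<forall>s \<in> S. \<forall>s' \<in> S. s \<noteq> s' \<longrightarrow> \<not> [s = s'] (mod int k))"
proof -
  let ?G = "integer_mod_group n"
  let ?K = "{x \<in> carrier ?G. int k dvd x}"
  interpret group ?G
    by simp
  have carrier: "carrier ?G = {0..<int n}"
    using assms(1) by (simp add: carrier_integer_mod_group)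
  have "k > 0"
    using assms(1,6) by (cases k) auto
  \<comment> \<open>Residues mod \<open>k\<close> are well defined on the group because
    \<open>k\<close> divides \<open>n\<close>.\<close>
  have mod_n: "[x mod int n = x] (mod int k)" for x
    using assms(6) by (metis cong_def int_dvd_int_iff mod_mod_cancel)
  have "finite S"
    using assms(2) carrier finite_subset by fastforce
  have no_square: "x \<otimes>\<^bsub>?G\<^esub> x \<notin> S" if "x \<in> carrier ?G" for x
    using \<open>finite S\<close> assms(4) that unfolding assms(5)
    by (rule square_notin_if_regular_cayley_sum_graph)
  have code_iff: "subgroup_total_perfect_code ?G S C \<longleftrightarrow>
      subgroup C ?G \<and> (\<forall>v \<in> carrier ?G. \<exists>!c. c \<in> C \<and> v \<otimes>\<^bsub>?G\<^esub> c \<in> S)" for C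
  proof (cases "subgroup C ?G")
    case True
    then show ?thesis
      using total_perfect_code_cayley_sum_graph_iff[OF no_square subgroup.subset[OF True]]
      by (simp only: subgroup_total_perfect_code_def)
  qed (simp add: subgroup_total_perfect_code_def)
  show ?thesis
  proof
    assume "\<exists>C. subgroup_total_perfect_code ?G S C"
    then obtain C where C: "subgroup C ?G"
      and unique: "\<forall>v \<in> carrier ?G. \<exists>!c. c \<in> C \<and> v \<otimes>\<^bsub>?G\<^esub> c \<in> S"
      unfolding code_iff by blast
    have "card S * card C = order ?G"
      using assms(2) subgroup.subset[OF C] unique by (rule card_mult_card_eq_order)
    then have "card C * k = n"
      using assms(5) by (simp add: order_def carrier mult.commute)
    then have C_eq: "C = ?K"
      using assms(1) C by (intro subgroup_integer_mod_group_eq_multiples) auto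
    show "\<forall>s \<in> S. \<forall>s' \<in> S. s \<noteq> s' \<longrightarrow> \<not> [s = s'] (mod int k)"
    proof (intro ballI impI notI)
      fix s s' assume s: "s \<in> S" "s' \<in> S" "s \<noteq> s'" "[s = s'] (mod int k)"
      have range: "0 \<le> s" "s < int n" "0 \<le> s'" "s' < int n"
        using s assms(2) carrier by auto
      \<comment> \<open>This is the group difference of \<open>s'\<close> and \<open>s\<close>, a
        multiple of \<open>k\<close> and so in \<open>C\<close>. At the vertex \<open>s\<close>,
        both \<open>0\<close> and \<open>c\<close> then give sums in \<open>S\<close>, namely
        \<open>s\<close> and \<open>s'\<close>, against uniqueness.\<close>
      define c where "c = (s' - s) mod int n"
      have "[c = 0] (mod int k)"
        using mod_n[of "s' - s"] s(4) unfolding c_def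
        by (metis cong_diff_iff_cong_0 cong_sym cong_trans)
      then have "c \<in> C"
        using assms(1) by (simp add: C_eq carrier cong_0_iff c_def)
      moreover have s_c: "s \<otimes>\<^bsub>?G\<^esub> c = s'"
        using range by (simp add: c_def mod_add_right_eq)
      moreover have "0 \<in> C" "s \<otimes>\<^bsub>?G\<^esub> 0 = s"
        using range assms(1) by (simp_all add: C_eq carrier)
      moreover have "s \<in> carrier ?G"
        using s assms(2) by auto
      ultimately have "c = 0"
        using unique s by metis
      then show False
        using s_c \<open>s \<otimes>\<^bsub>?G\<^esub> 0 = s\<close> s(3) by simp
    qed
  next
    assume distinct: "\<forall>s \<in> S. \<forall>s' \<in> S. s \<noteq> s' \<longrightarrow> \<not> [s = s'] (mod int k)"
    have "inj_on (\<lambda>s. s mod int k) S"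
      using distinct by (auto simp: inj_on_def cong_def)
    then have "card ((\<lambda>s. s mod int k) ` S) = card {0..<int k}"
      using assms(5) by (simp add: card_image)
    moreover have "(\<lambda>s. s mod int k) ` S \<subseteq> {0..<int k}"
      using \<open>k > 0\<close> by auto
    \<comment> \<open>\<open>S\<close> has exactly \<open>k\<close> elements, so pairwise
      incongruent ones exhaust the residues mod \<open>k\<close>.\<close>
    ultimately have surj: "(\<lambda>s. s mod int k) ` S = {0..<int k}"
      by (intro card_subset_eq) auto
    have "\<exists>!c. c \<in> ?K \<and> v \<otimes>\<^bsub>?G\<^esub> c \<in> S" if v: "v \<in> carrier ?G" for v
    proof -
      have "v mod int k \<in> (\<lambda>s. s mod int k) ` S"
        using surj \<open>k > 0\<close> by simp
      then obtain s where s: "s \<in> S" "[s = v] (mod int k)"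
        by (auto simp: cong_def)
      have range: "0 \<le> s" "s < int n"
        using s assms(2) carrier by auto
      \<comment> \<open>Adding an element of \<open>?K\<close> keeps the residue class of
        \<open>v\<close>, and \<open>s\<close> is the only element of \<open>S\<close> in that
        class.\<close>
      have s_unique: "v \<otimes>\<^bsub>?G\<^esub> c = s" if "c \<in> ?K" "v \<otimes>\<^bsub>?G\<^esub> c \<in> S" for c
      proof -
        have "[v + c = v] (mod int k)"
          using that(1) by (simp add: cong_iff_dvd_diff)
        then have "[v \<otimes>\<^bsub>?G\<^esub> c = s] (mod int k)"
          using mod_n[of "v + c"] s(2) by (metis cong_sym cong_trans mult_integer_mod_group)
        then show ?thesis
          using distinct s(1) that(2) by blast
      qed
      show ?thesis
      proof (rule ex_ex1I)
        have "[(s - v) mod int n = 0] (mod int k)"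
          using mod_n[of "s - v"] s(2) by (metis cong_diff_iff_cong_0 cong_trans)
        then have "(s - v) mod int n \<in> ?K"
          using assms(1) by (simp add: carrier cong_0_iff)
        moreover have "v \<otimes>\<^bsub>?G\<^esub> ((s - v) mod int n) = s"
          using range by (simp add: mod_add_right_eq)
        ultimately show "\<exists>c. c \<in> ?K \<and> v \<otimes>\<^bsub>?G\<^esub> c \<in> S"
          using s(1) by metis
      next
        fix c d assume c: "c \<in> ?K \<and> v \<otimes>\<^bsub>?G\<^esub> c \<in> S" and d: "d \<in> ?K \<and> v \<otimes>\<^bsub>?G\<^esub> d \<in> S"
        then have "v \<otimes>\<^bsub>?G\<^esub> c = v \<otimes>\<^bsub>?G\<^esub> d"
          using s_unique[of c] s_unique[of d] by (simp only:)
        moreover have "c \<in> carrier ?G" "d \<in> carrier ?G"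
          using c d by simp_all
        ultimately show "c = d"
          \<comment> \<open>Both sums equal \<open>s\<close>, so cancelling \<open>v\<close>
            identifies \<open>c\<close> with \<open>d\<close>.\<close>
          using v Units_l_cancel unfolding Units_eq by blast
      qed
    qed
    then have "subgroup_total_perfect_code ?G S ?K"
      using subgroup_multiples_integer_mod_group[OF assms(6)] unfolding code_iff by blast
    then show "\<exists>C. subgroup_total_perfect_code ?G S C" ..
  qed
qed

end
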